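(* Let $\rho \in [0,1)$ and let $M \ge 1$ be an integer. Let $\Sigma_e \in \mathbb{R}^{M\times M}$ be the matrix with entries $\rho^{|i-j|}$, let $C_{\Sigma_e}$ be the $M\times M$ circulant matrix with first row $(c_0,\dots,c_{M-1})$ given by $c_m = \rho^m + \frac{m}{M}(\rho^{M-m} - \rho^m)$ for $0 \le m \le M-1$, and let $R_{\Sigma_e} = \Sigma_e - C_{\Sigma_e}$. Then $$\frac{1}{M}\|R_{\Sigma_e}\|_F^2 = \frac{2\rho^2}{M(1-\rho^2)}\left[ \frac{1+\rho^{2(M-1)}}{1-\rho^2} - \frac{1+\rho^2+\rho^{2(M-1)} - 3\rho^{2M}}{M(1-\rho^2)^2} - \rho^{2(M-1)}\,\frac{M-1}{M} \right] - \frac{1}{3}\rho^M\left(M - \frac{1}{M}\right).$$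
   Context: A matrix $C$ is circulant with first row $(c_0, c_1, \dots, c_{M-1})$ if $C_{ij} = c_{(j-i) \bmod M}$. The Frobenius norm of a real matrix $A$ is $\|A\|_F = \sqrt{\operatorname{trace}(A^{\mathsf{T}}A)}$. The convention $0^0=1$ is used. *)

theory Defs
  imports Complex_Main "Jordan_Normal_Form.Matrix"
begin

text \<open>Matrix indices run from \<open>0\<close> to \<open>M - 1\<close>; the exponents are natural numbers, so \<open>0 ^ 0 = 1\<close>.\<close>

definition mat_trace :: "real mat \<Rightarrow> real" where
  "mat_trace A = (\<Sum>i<dim_row A. A $$ (i, i))"

definition frobenius_norm :: "real mat \<Rightarrow> real" where
  "frobenius_norm A = sqrt (mat_trace (transpose_mat A * A))"

text \<open>The integer \<open>mod\<close> lies in \<open>{0..<M}\<close> also for negative \<open>j - i\<close>.\<close>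

definition circulant_mat :: "nat \<Rightarrow> (nat \<Rightarrow> real) \<Rightarrow> real mat" where
  "circulant_mat M c = mat M M (\<lambda>(i, j). c (nat ((int j - int i) mod int M)))"

definition Sigma_e :: "nat \<Rightarrow> real \<Rightarrow> real mat" where
  "Sigma_e M \<rho> = mat M M (\<lambda>(i, j). \<rho> ^ nat \<bar>int i - int j\<bar>)"

text \<open>Only the values at \<open>m < M\<close> matter, so the subtraction \<open>M - m\<close> does not truncate.\<close>

definition c_Sigma_e :: "nat \<Rightarrow> real \<Rightarrow> nat \<Rightarrow> real" where
  "c_Sigma_e M \<rho> m = \<rho> ^ m + real m / real M * (\<rho> ^ (M - m) - \<rho> ^ m)"

definition C_Sigma_e :: "nat \<Rightarrow> real \<Rightarrow> real mat" where
  "C_Sigma_e M \<rho> = circulant_mat M (c_Sigma_e M \<rho>)"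

definition R_Sigma_e :: "nat \<Rightarrow> real \<Rightarrow> real mat" where
  "R_Sigma_e M \<rho> = Sigma_e M \<rho> - C_Sigma_e M \<rho>"

end

theory Submission
  imports Defs
begin

text \<open>
  The residual vanishes on the diagonal and depends only on the distance to it: at distance \<open>d\<close>
  its entry is \<open>(d/M) (\<rho>^d - \<rho>^(M-d))\<close>.  Above the diagonal the circulant entry is \<open>c_d\<close>, and below
  it is \<open>c_(M-d)\<close>; the linear weights in \<open>c\<close> are chosen so that both give the same residual
  (lemma \<open>R_Sigma_e_entry\<close>).  Counting the \<open>2 (M-d)\<close> entries at distance \<open>d > 0\<close>
  (lemma \<open>sum_over_distances\<close>) gives the squared norm
  \<open>(2/M^2) (\<Sum>d\<le>M. (M-d) d^2 (\<rho>^d - \<rho>^(M-d))^2)\<close>.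
  The squared bracket is invariant under \<open>d \<mapsto> M-d\<close>.  Averaging the sum with its reflection replaces
  the weight \<open>d^2 (M-d)\<close> by \<open>M d (M-d) / 2\<close>, which is symmetric, so that expanding the square yields
  \<open>(2/M) ((\<Sum>d\<le>M. d (M-d) \<rho>^(2d)) - \<rho>^M (\<Sum>d\<le>M. d (M-d)))\<close>.
  The two sums have the closed forms of \<open>sum_times_reflection_geometric\<close> at \<open>x = \<rho>^2\<close> and of
  \<open>sum_times_reflection\<close>; the latter is the source of the isolated last term of the formula.
\<close>

section \<open>Frobenius norm and matrices depending on the distance to the diagonal\<close>

lemma frobenius_norm_square:
  assumes "A \<in> carrier_mat n m"
  shows "(frobenius_norm A)\<^sup>2 = (\<Sum>j<m. \<Sum>i<n. (A $$ (i, j))\<^sup>2)"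
proof -
  have "mat_trace (transpose_mat A * A) = (\<Sum>j<m. \<Sum>i<n. (A $$ (i, j))\<^sup>2)"
    using assms
    by (auto simp: mat_trace_def scalar_prod_def power2_eq_square atLeast0LessThan
        intro!: sum.cong)
  moreover have "\<dots> \<ge> 0"
    by (intro sum_nonneg) auto
  ultimately show ?thesis
    by (simp add: frobenius_norm_def)
qed

text \<open>
  A square with sides of length \<open>n + 1\<close> arises from one with sides \<open>n\<close> by adding a corner and two
  arms, each of which meets every distance \<open>1, \<dots>, n\<close> exactly once.  The diagonal is counted
  twice on the right, hence the correction.
\<close>

lemma sum_over_distances:
  fixes f :: "nat \<Rightarrow> real"
  shows "(\<Sum>j<n. \<Sum>i<n. f (nat \<bar>int i - int j\<bar>))
    = 2 * (\<Sum>d\<le>n. real (n - d) * f d) - real n * f 0"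
proof (induction n)
  case 0
  show ?case by simp
next
  case (Suc n)
  have arm: "(\<Sum>i<n. f (n - i)) = (\<Sum>d\<le>n. f d) - f 0"
  proof -
    have "(\<Sum>i<n. f (n - i)) = (\<Sum>d\<in>{1..n}. f d)"
      by (rule sum.reindex_bij_witness[of _ "\<lambda>d. n - d" "\<lambda>i. n - i"]) auto
    also have "\<dots> = (\<Sum>d\<le>n. f d) - f 0"
      by (simp add: atMost_atLeast0 sum.atLeast_Suc_atMost[of 0])
    finally show ?thesis .
  qed
  have column: "(\<Sum>i<n. f (nat \<bar>int i - int n\<bar>)) = (\<Sum>i<n. f (n - i))"
    by (intro sum.cong refl arg_cong[of _ _ f]) auto
  have row: "(\<Sum>j<n. f (nat \<bar>int n - int j\<bar>)) = (\<Sum>i<n. f (n - i))"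
    by (intro sum.cong refl arg_cong[of _ _ f]) auto
  have weights: "(\<Sum>d\<le>Suc n. real (Suc n - d) * f d)
      = (\<Sum>d\<le>n. real (n - d) * f d) + (\<Sum>d\<le>n. f d)"
    by (simp add: sum.distrib[symmetric] Suc_diff_le algebra_simps cong: sum.cong_simp)
  show ?case
    unfolding weights
    by (simp only: sum.lessThan_Suc sum.distrib Suc.IH row column arm)
      (simp add: algebra_simps)
qed

text \<open>
  Below the diagonal the circulant index wraps around to \<open>M - d\<close>; the weight \<open>1 - (M - d) / M\<close>
  left on the residual there equals the weight \<open>d / M\<close> above the diagonal.
\<close>

lemma R_Sigma_e_entry:
  assumes "i < M" "j < M"
  defines "d \<equiv> nat \<bar>int i - int j\<bar>"
  shows "R_Sigma_e M \<rho> $$ (i, j) = real d / real M * (\<rho> ^ d - \<rho> ^ (M - d))"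
proof (cases "i \<le> j")
  case True
  have d: "d = j - i"
    using True by (simp add: d_def)
  have "(int j - int i) mod int M = int j - int i"
    using True assms(1,2) by (intro mod_pos_pos_trivial) auto
  then have residue: "nat ((int j - int i) mod int M) = d"
    using True d by simp
  have "R_Sigma_e M \<rho> $$ (i, j) = \<rho> ^ d - c_Sigma_e M \<rho> d"
    using assms(1,2) residue
    by (simp add: R_Sigma_e_def Sigma_e_def C_Sigma_e_def circulant_mat_def d_def[symmetric])
  also have "\<dots> = real d / real M * (\<rho> ^ d - \<rho> ^ (M - d))"
    by (simp add: c_Sigma_e_def algebra_simps)
  finally show ?thesis .
next
  case False
  have d: "d = i - j" "d \<le> M" "d > 0"
    using False assms by (auto simp: d_def)
  have "(int j - int i) mod int M = (int j - int i + int M) mod int M"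
    by simp
  also have "\<dots> = int j - int i + int M"
    using False assms by (intro mod_pos_pos_trivial) auto
  finally have residue: "nat ((int j - int i) mod int M) = M - d"
    using False assms d by auto
  have "R_Sigma_e M \<rho> $$ (i, j) = \<rho> ^ d - c_Sigma_e M \<rho> (M - d)"
    using assms(1,2) residue
    by (simp add: R_Sigma_e_def Sigma_e_def C_Sigma_e_def circulant_mat_def d_def[symmetric])
  also have "\<dots> = real d / real M * (\<rho> ^ d - \<rho> ^ (M - d))"
    using d assms(1) by (simp add: c_Sigma_e_def of_nat_diff field_simps)
  finally show ?thesis .
qed

section \<open>Sums weighted by an index and its reflection\<close>

text \<open>
  Reflecting \<open>d \<mapsto> n - d\<close> turns the weight \<open>d^2 (n - d)\<close> into \<open>d (n - d)^2\<close>, and the two add up to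
  \<open>n d (n - d)\<close>.
\<close>

lemma sum_symmetrize_weight:
  fixes g :: "nat \<Rightarrow> real"
  assumes "\<And>d. d \<le> n \<Longrightarrow> g (n - d) = g d"
  shows "2 * (\<Sum>d\<le>n. real (n - d) * (real d)\<^sup>2 * g d)
    = real n * (\<Sum>d\<le>n. real d * real (n - d) * g d)"
proof -
  have reflect: "(\<Sum>d\<le>n. real (n - d) * (real d)\<^sup>2 * g d)
      = (\<Sum>d\<le>n. real d * (real (n - d))\<^sup>2 * g d)"
    by (rule sum.reindex_bij_witness[of _ "\<lambda>d. n - d" "\<lambda>d. n - d"]) (auto simp: assms)
  have "2 * (\<Sum>d\<le>n. real (n - d) * (real d)\<^sup>2 * g d)
      = (\<Sum>d\<le>n. real (n - d) * (real d)\<^sup>2 * g d + real d * (real (n - d))\<^sup>2 * g d)"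
    by (simp only: sum.distrib mult_2 reflect)
  also have "\<dots> = (\<Sum>d\<le>n. real n * (real d * real (n - d) * g d))"
    by (intro sum.cong refl) (simp add: of_nat_diff power2_eq_square algebra_simps)
  finally show ?thesis
    by (simp add: sum_distrib_left)
qed

text \<open>
  Raising \<open>n\<close> by one raises every reflected index by one, and the new summand vanishes.  The closed
  forms below therefore follow by induction from those of the sums with weight \<open>d\<close> alone.
\<close>

lemma sum_times_reflection_Suc:
  fixes g :: "nat \<Rightarrow> real"
  shows "(\<Sum>d\<le>Suc n. real d * real (Suc n - d) * g d)
    = (\<Sum>d\<le>n. real d * real (n - d) * g d) + (\<Sum>d\<le>n. real d * g d)"
  by (simp add: sum.distrib[symmetric] Suc_diff_le algebra_simps cong: sum.cong_simp)

lemma sum_times_reflection: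
  "(\<Sum>d\<le>n. real d * real (n - d)) = real n * ((real n)\<^sup>2 - 1) / 6"
proof (induction n)
  case 0
  show ?case by simp
next
  case (Suc n)
  have "(\<Sum>d\<le>n. real d) = real n * (real n + 1) / 2"
    by (induction n) (simp_all add: field_simps)
  then show ?case
    using sum_times_reflection_Suc[of n "\<lambda>_. 1"] Suc.IH
    by (simp add: field_simps power2_eq_square)
qed

lemma sum_index_geometric:
  fixes x :: real
  shows "(1 - x)\<^sup>2 * (\<Sum>d\<le>n. real d * x ^ d)
    = x - (real n + 1) * x ^ (n + 1) + real n * x ^ (n + 2)"
  by (induction n) (simp_all add: algebra_simps power2_eq_square)

lemma sum_times_reflection_geometric:
  fixes x :: real
  shows "(1 - x) ^ 3 * (\<Sum>d\<le>n. real d * real (n - d) * x ^ d)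
    = real n * x * (1 - x) * (1 + x ^ n) - x * (1 + x) * (1 - x ^ n)"
proof (induction n)
  case 0
  show ?case by simp
next
  case (Suc n)
  let ?S = "\<Sum>d\<le>n. real d * real (n - d) * x ^ d"
  let ?T = "\<Sum>d\<le>n. real d * x ^ d"
  have "(1 - x) ^ 3 * (\<Sum>d\<le>Suc n. real d * real (Suc n - d) * x ^ d)
      = (1 - x) ^ 3 * ?S + (1 - x) * ((1 - x)\<^sup>2 * ?T)"
    unfolding sum_times_reflection_Suc
    by (simp only: distrib_left power3_eq_cube power2_eq_square mult.assoc)
  also have "\<dots> = real (Suc n) * x * (1 - x) * (1 + x ^ Suc n) - x * (1 + x) * (1 - x ^ Suc n)"
    unfolding Suc.IH sum_index_geometric
    by (simp add: algebra_simps)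
  finally show ?case .
qed

section \<open>The norm of the residual\<close>

lemma frobenius_norm_R_Sigma_e_square:
  assumes "M \<ge> 1"
  shows "(frobenius_norm (R_Sigma_e M \<rho>))\<^sup>2
    = 2 / real M * ((\<Sum>d\<le>M. real d * real (M - d) * (\<rho>\<^sup>2) ^ d)
        - \<rho> ^ M * (\<Sum>d\<le>M. real d * real (M - d)))"
proof -
  let ?g = "\<lambda>d. (\<rho> ^ d - \<rho> ^ (M - d))\<^sup>2"
  let ?f = "\<lambda>d. (real d / real M * (\<rho> ^ d - \<rho> ^ (M - d)))\<^sup>2"
  let ?P = "\<Sum>d\<le>M. real d * real (M - d) * (\<rho>\<^sup>2) ^ d"
  let ?Q = "\<Sum>d\<le>M. real d * real (M - d)"
  have carrier: "R_Sigma_e M \<rho> \<in> carrier_mat M M"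
    by (auto simp: R_Sigma_e_def Sigma_e_def C_Sigma_e_def circulant_mat_def)
  have reflect: "(\<Sum>d\<le>M. real d * real (M - d) * (\<rho>\<^sup>2) ^ (M - d)) = ?P"
    by (rule sum.reindex_bij_witness[of _ "\<lambda>d. M - d" "\<lambda>d. M - d"]) auto
  have square: "?g d = (\<rho>\<^sup>2) ^ d + (\<rho>\<^sup>2) ^ (M - d) - 2 * \<rho> ^ M" if "d \<le> M" for d
  proof -
    have "\<rho> ^ d * \<rho> ^ (M - d) = \<rho> ^ M"
      using that by (simp add: power_add[symmetric])
    then show ?thesis
      by (simp add: power2_diff power_mult[symmetric] mult.commute mult.left_commute)
  qed
  have expand: "(\<Sum>d\<le>M. real d * real (M - d) * ?g d) = 2 * (?P - \<rho> ^ M * ?Q)"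
  proof -
    have "(\<Sum>d\<le>M. real d * real (M - d) * ?g d)
        = (\<Sum>d\<le>M. real d * real (M - d) * (\<rho>\<^sup>2) ^ d
            + real d * real (M - d) * (\<rho>\<^sup>2) ^ (M - d)
            - 2 * \<rho> ^ M * (real d * real (M - d)))"
      by (intro sum.cong refl, subst square) (simp_all add: algebra_simps)
    also have "\<dots> = ?P + ?P - 2 * \<rho> ^ M * ?Q"
      by (simp only: sum.distrib sum_subtractf reflect sum_distrib_left[symmetric])
    finally show ?thesis
      by (simp add: algebra_simps)
  qed
  have "(frobenius_norm (R_Sigma_e M \<rho>))\<^sup>2 = (\<Sum>j<M. \<Sum>i<M. ?f (nat \<bar>int i - int j\<bar>))"
    by (auto simp: frobenius_norm_square[OF carrier] R_Sigma_e_entry intro!: sum.cong)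
  also have "\<dots> = 2 * (\<Sum>d\<le>M. real (M - d) * ?f d)"
    unfolding sum_over_distances[of ?f] by simp
  also have "\<dots> = 1 / (real M)\<^sup>2 * (2 * (\<Sum>d\<le>M. real (M - d) * (real d)\<^sup>2 * ?g d))"
    by (simp add: sum_distrib_left power_mult_distrib power_divide mult_ac)
  also have "2 * (\<Sum>d\<le>M. real (M - d) * (real d)\<^sup>2 * ?g d)
      = real M * (\<Sum>d\<le>M. real d * real (M - d) * ?g d)"
    by (rule sum_symmetrize_weight) (simp add: power2_commute)
  finally show ?thesis
    unfolding expand using assms by (simp add: power2_eq_square)
qed

theorem mainTheorem5:
  fixes \<rho> :: real and M :: nat
  assumes "0 \<le> \<rho>" and "\<rho> < 1" and "M \<ge> 1"
  shows "1 / real M * (frobenius_norm (R_Sigma_e M \<rho>))\<^sup>2 =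
    2 * \<rho>\<^sup>2 / (real M * (1 - \<rho>\<^sup>2)) *
      ((1 + \<rho> ^ (2 * (M - 1))) / (1 - \<rho>\<^sup>2)
       - (1 + \<rho>\<^sup>2 + \<rho> ^ (2 * (M - 1)) - 3 * \<rho> ^ (2 * M)) / (real M * (1 - \<rho>\<^sup>2)\<^sup>2)
       - \<rho> ^ (2 * (M - 1)) * ((real M - 1) / real M))
    - 1 / 3 * \<rho> ^ M * (real M - 1 / real M)"
proof -
  define x where "x = \<rho>\<^sup>2"
  define y where "y = x ^ (M - 1)"
  define N where "N = real M"
  have x: "1 - x \<noteq> 0"
    using assms(1,2) by (simp add: x_def power2_eq_1_iff)
  have N: "N \<noteq> 0"
    using assms(3) by (simp add: N_def)
  have xM: "x ^ M = x * y"
    using assms(3) by (cases M) (auto simp: y_def)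
  have powers: "\<rho> ^ (2 * (M - 1)) = y" "\<rho> ^ (2 * M) = x * y"
    by (simp_all only: xM[symmetric]) (simp_all only: power_mult y_def x_def)
  have S: "(\<Sum>d\<le>M. real d * real (M - d) * x ^ d)
      = (N * x * (1 - x) * (1 + x * y) - x * (1 + x) * (1 - x * y)) / (1 - x) ^ 3"
    using sum_times_reflection_geometric[of x M] x
    by (simp add: nonzero_eq_divide_eq xM N_def mult.commute[of _ "(1 - x) ^ 3"])
  have geometric_part: "2 / N\<^sup>2
        * ((N * x * (1 - x) * (1 + x * y) - x * (1 + x) * (1 - x * y)) / (1 - x) ^ 3)
      = 2 * x / (N * (1 - x)) * ((1 + y) / (1 - x)
          - (1 + x + y - 3 * (x * y)) / (N * (1 - x)\<^sup>2) - y * ((N - 1) / N))"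
  proof -
    let ?A = "1 + x + y - 3 * (x * y)"
    (* With 1 - x as an atom the denominators are monomials. *)
    define u where "u = 1 - x"
    have u: "u \<noteq> 0"
      using x by (simp add: u_def)
    have numerator: "N * x * u * (1 + x * y) - x * (1 + x) * (1 - x * y)
        = x * (N * u * (1 + y) - ?A - y * (N - 1) * u\<^sup>2)"
      by (simp add: u_def power2_eq_square algebra_simps)
    have bracket: "(1 + y) / u - ?A / (N * u\<^sup>2) - y * ((N - 1) / N)
        = (N * u * (1 + y) - ?A - y * (N - 1) * u\<^sup>2) / (N * u\<^sup>2)"
      using N u
      by (simp add: diff_divide_distrib right_diff_distrib left_diff_distrib power2_eq_square)
    show ?thesis
      unfolding u_def[symmetric] numerator bracket
      by (simp add: power2_eq_square power3_eq_cube mult_ac)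
  qed
  have spread: "1 / N * (2 / N * (P - r * Q)) = 2 / N\<^sup>2 * P - 2 / N\<^sup>2 * r * Q" for P r Q
    by (simp add: power2_eq_square right_diff_distrib diff_divide_distrib)
  have "1 / N * (frobenius_norm (R_Sigma_e M \<rho>))\<^sup>2
      = 2 / N\<^sup>2 * (\<Sum>d\<le>M. real d * real (M - d) * x ^ d)
        - 2 / N\<^sup>2 * \<rho> ^ M * (N * (N\<^sup>2 - 1) / 6)"
    unfolding frobenius_norm_R_Sigma_e_square[OF assms(3)] sum_times_reflection
      x_def[symmetric] N_def[symmetric] spread ..
  also have "2 / N\<^sup>2 * \<rho> ^ M * (N * (N\<^sup>2 - 1) / 6) = 1 / 3 * \<rho> ^ M * (N - 1 / N)"
    using N by (simp add: field_simps power2_eq_square)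
  finally show ?thesis
    unfolding S geometric_part powers x_def[symmetric] N_def[symmetric] .
qed

end
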